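(* Let $I\subset(0,1)$ be a segment and let $G$ be a group of diffeomorphisms in $\mathrm{Diff}^1_+([0,1])$ supported in $I$ (i.e. each $g\in G$ is the identity outside $I$) which is $C^1$-close to the identity. Let $f\in \mathrm{Diff}^1_+([0,1])$ be a diffeomorphism without hyperbolic fixed points such that $f(I)\cap I=\emptyset$. Then the group $\langle f,G\rangle$ generated by $f$ and $G$ is $C^1$-close to the identity.
   Context: A group $G\subset \mathrm{Diff}^1_+([0,1])$ is $C^1$-close to the identity if there is a sequence $h_n\in \mathrm{Diff}^1_+([0,1])$ such that $h_n g h_n^{-1}\to \mathrm{id}$ in the $C^1$-topology as $n\to\infty$, for every $g\in G$. A diffeomorphism $f$ is without hyperbolic fixed points if $Df(x)=1$ for every fixed point $x$ of $f$. *)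

theory Defs
  imports "HOL-Analysis.Analysis"
begin

text \<open>Elements of Diff^1_+([0,1]) are represented as functions real => real that are
  the identity outside [0,1] (so that composition is the group operation).\<close>

definition Dw :: "(real \<Rightarrow> real) \<Rightarrow> real \<Rightarrow> real" where
  "Dw f x = (SOME d. (f has_real_derivative d) (at x within {0..1}))"

definition Diff1p :: "(real \<Rightarrow> real) set" where
  "Diff1p = {f. bij_betw f {0..1} {0..1} \<and> f 0 = 0 \<and> f 1 = 1
      \<and> (\<forall>x. x \<notin> {0..1} \<longrightarrow> f x = x)
      \<and> (\<exists>Df. continuous_on {0..1} Df
             \<and> (\<forall>x\<in>{0..1}. (f has_real_derivative Df x) (at x within {0..1}) \<and> Df x > 0))}"

definition dinv :: "(real \<Rightarrow> real) \<Rightarrow> real \<Rightarrow> real" where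
  "dinv f = (\<lambda>y. if y \<in> {0..1} then the_inv_into {0..1} f y else y)"

definition diff_group :: "(real \<Rightarrow> real) set \<Rightarrow> bool" where
  "diff_group G \<longleftrightarrow> G \<subseteq> Diff1p \<and> id \<in> G \<and> (\<forall>g\<in>G. \<forall>k\<in>G. g \<circ> k \<in> G)
      \<and> (\<forall>g\<in>G. dinv g \<in> G)"

inductive_set gen_group :: "(real \<Rightarrow> real) set \<Rightarrow> (real \<Rightarrow> real) set" for S where
  gen_id: "id \<in> gen_group S"
| gen_base: "s \<in> S \<Longrightarrow> s \<in> gen_group S"
| gen_comp: "g \<in> gen_group S \<Longrightarrow> k \<in> gen_group S \<Longrightarrow> g \<circ> k \<in> gen_group S"
| gen_inv: "g \<in> gen_group S \<Longrightarrow> dinv g \<in> gen_group S"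

definition C1_to_id :: "(nat \<Rightarrow> real \<Rightarrow> real) \<Rightarrow> bool" where
  "C1_to_id \<phi> \<longleftrightarrow> (\<forall>\<epsilon>>0. \<forall>\<^sub>F n in sequentially.
      \<forall>x\<in>{0..1}. \<bar>\<phi> n x - x\<bar> < \<epsilon> \<and> \<bar>Dw (\<phi> n) x - 1\<bar> < \<epsilon>)"

definition C1_close_id :: "(real \<Rightarrow> real) set \<Rightarrow> bool" where
  "C1_close_id G \<longleftrightarrow> (\<exists>h :: nat \<Rightarrow> real \<Rightarrow> real. (\<forall>n. h n \<in> Diff1p)
      \<and> (\<forall>g\<in>G. C1_to_id (\<lambda>n. h n \<circ> g \<circ> dinv (h n))))"

definition no_hyp_fixed :: "(real \<Rightarrow> real) \<Rightarrow> bool" where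
  "no_hyp_fixed f \<longleftrightarrow> (\<forall>x\<in>{0..1}. f x = x \<longrightarrow> Dw f x = 1)"

end

theory Submission
  imports Defs
begin

text \<open>
  For a diffeomorphism \<open>H\<close> put \<open>u = ln DH\<close>. Then \<open>ln D(H g H\<inverse>)\<close> at \<open>H x\<close> equals
  \<open>u (g x) - u x + ln (Dg x)\<close>. This cocycle only sees \<open>u\<close> up to an additive constant, and every
  continuous \<open>u\<close> arises, up to a constant, from some \<open>H\<close>. So, if \<open>h\<close> conjugates \<open>G\<close> close to the
  identity, it suffices to find a continuous \<open>u\<close> on \<open>[0,1]\<close> that equals \<open>ln Dh\<close> on the segment \<open>I\<close>
  and for which \<open>u \<circ> f - u + ln Df\<close> is uniformly small.

  First, \<open>u\<^sub>0 = \<Sum>k<N. (1 - k/N) (ln Df \<circ> f^k)\<close> solves the second condition up to a Birkhoff average of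
  \<open>ln Df\<close>. Since \<open>ln Df\<close> vanishes on the fixed points, it is bounded by \<open>\<epsilon> + C \<bar>f x - x\<bar>\<close>, and
  orbits are monotone in \<open>[0,1]\<close>, so these averages tend to \<open>0\<close> uniformly. Second, \<open>ln Dh - u\<^sub>0\<close> is
  extended from \<open>I\<close> to a function \<open>p\<close> supported in a fundamental domain of \<open>f\<close>; the sum
  \<open>\<Sum>\<bar>k\<bar><N. (1 - \<bar>k\<bar>/N) (p \<circ> f^k)\<close> still equals \<open>p\<close> on \<open>I\<close> and is almost \<open>f\<close>-invariant, because an
  orbit meets the fundamental domain at most once.
\<close>

subsection \<open>The group of diffeomorphisms\<close>

text \<open>\<open>Dw\<close> is picked by choice. The choice is forced because every point of
  \<open>{0..1}\<close>, endpoints included, is a limit point of \<open>{0..1}\<close>, so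
  derivatives within the interval are unique.\<close>

lemma Dw_eq:
  assumes "(f has_real_derivative d) (at x within {0..1})" "x \<in> {0..1}"
  shows "Dw f x = d"
proof -
  have "at x within {0..1} \<noteq> bot"
    using assms(2) islimpt_Icc[of 0 1 x] by (simp add: trivial_limit_within)
  moreover have "(f has_real_derivative Dw f x) (at x within {0..1})"
    unfolding Dw_def using assms(1) by (rule someI)
  ultimately show ?thesis
    using has_field_derivative_unique assms(1) by blast
qed

lemma has_real_derivative_Dw:
  assumes "f \<in> Diff1p" "x \<in> {0..1}"
  shows "(f has_real_derivative Dw f x) (at x within {0..1})"
proof -
  from assms obtain d where "(f has_real_derivative d) (at x within {0..1})"
    unfolding Diff1p_def by blast
  with Dw_eq[OF this assms(2)] show ?thesis by simp
qed

lemma Dw_pos: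
  assumes "f \<in> Diff1p" "x \<in> {0..1}"
  shows "Dw f x > 0"
proof -
  from assms obtain d where "(f has_real_derivative d) (at x within {0..1})" "d > 0"
    unfolding Diff1p_def by blast
  with Dw_eq[OF this(1) assms(2)] show ?thesis by simp
qed

lemma continuous_on_Dw:
  assumes "f \<in> Diff1p"
  shows "continuous_on {0..1} (Dw f)"
proof -
  from assms obtain D where "continuous_on {0..1} D"
    and D: "\<And>x. x \<in> {0..1} \<Longrightarrow> (f has_real_derivative D x) (at x within {0..1})"
    unfolding Diff1p_def by blast
  then show ?thesis
    by (subst continuous_on_cong[OF refl Dw_eq[OF D]]) auto
qed

lemma continuous_on_ln_Dw:
  assumes "f \<in> Diff1p"
  shows "continuous_on {0..1} (\<lambda>x. ln (Dw f x))"
  by (intro continuous_on_ln continuous_on_Dw assms ballI less_imp_neq[THEN not_sym] Dw_pos)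

lemma mvt_unit_interval:
  fixes f D :: "real \<Rightarrow> real"
  assumes D: "\<And>x. x \<in> {0..1} \<Longrightarrow> (f has_real_derivative D x) (at x within {0..1})"
    and "0 \<le> x" "x < y" "y \<le> 1"
  obtains z where "z \<in> {0..1}" "f y - f x = D z * (y - x)"
proof -
  have "\<exists>z\<in>{x<..<y}. f y - f x = D z * (y - x)"
  proof (rule mvt_simple[OF \<open>x < y\<close>])
    fix z assume "x \<le> z" "z \<le> y"
    then have "(f has_real_derivative D z) (at z within {x..y})"
      using assms by (intro DERIV_subset[OF D]) auto
    then show "(f has_derivative (*) (D z)) (at z within {x..y})"
      by (simp add: has_field_derivative_def)
  qed
  then obtain z where "x < z" "z < y" "f y - f x = D z * (y - x)" by auto
  then show thesis
    using \<open>0 \<le> x\<close> \<open>y \<le> 1\<close> by (intro that[of z]) auto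
qed

text \<open>Bijectivity comes for free: a positive derivative gives strict monotonicity by the mean
  value theorem, and the fixed endpoints give surjectivity by the intermediate value
  theorem.\<close>

lemma Diff1pI:
  fixes f D :: "real \<Rightarrow> real"
  assumes f01: "f 0 = 0" "f 1 = 1" and out: "\<And>x. x \<notin> {0..1} \<Longrightarrow> f x = x"
    and D: "\<And>x. x \<in> {0..1} \<Longrightarrow> (f has_real_derivative D x) (at x within {0..1})"
    and Dpos: "\<And>x. x \<in> {0..1} \<Longrightarrow> D x > 0"
    and contD: "continuous_on {0..1} D"
  shows "f \<in> Diff1p"
proof -
  have mono: "f x < f y" if "0 \<le> x" "x < y" "y \<le> 1" for x y
    using mvt_unit_interval[of f D x y] D Dpos that
    by (metis diff_gt_0_iff_gt mult_pos_pos)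
  have cont: "continuous_on {0..1} f"
    by (rule DERIV_continuous_on[OF D])
  have "inj_on f {0..1}"
    by (rule linorder_inj_onI) (use mono in force)+
  moreover have "f ` {0..1} = {0..1}"
  proof
    show "f ` {0..1} \<subseteq> {0..1}"
    proof
      fix y assume "y \<in> f ` {0..1}"
      then obtain x where x: "0 \<le> x" "x \<le> 1" "y = f x" by auto
      then have "f 0 \<le> f x" "f x \<le> f 1"
        using mono[of 0 x] mono[of x 1] by (cases "x = 0"; cases "x = 1"; force)+
      then show "y \<in> {0..1}" using x f01 by auto
    qed
    show "{0..1} \<subseteq> f ` {0..1}"
    proof
      fix y :: real assume "y \<in> {0..1}"
      then show "y \<in> f ` {0..1}"
        using IVT'[of f 0 y 1] cont f01 by force
    qed
  qed
  ultimately show ?thesis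
    unfolding Diff1p_def bij_betw_def using assms by blast
qed

lemma Diff1p_id_outside: "f \<in> Diff1p \<Longrightarrow> x \<notin> {0..1} \<Longrightarrow> f x = x"
  unfolding Diff1p_def by blast

lemma Diff1p_image: "f \<in> Diff1p \<Longrightarrow> f ` {0..1} = {0..1}"
  unfolding Diff1p_def bij_betw_def by blast

lemma Diff1p_mem: "f \<in> Diff1p \<Longrightarrow> x \<in> {0..1} \<Longrightarrow> f x \<in> {0..1}"
  using Diff1p_image by blast

lemma Diff1p_zero: "f \<in> Diff1p \<Longrightarrow> f 0 = 0"
  and Diff1p_one: "f \<in> Diff1p \<Longrightarrow> f 1 = 1"
  unfolding Diff1p_def by auto

lemma continuous_on_Diff1p: "f \<in> Diff1p \<Longrightarrow> continuous_on {0..1} f"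
  by (rule DERIV_continuous_on[OF has_real_derivative_Dw])

text \<open>Monotonicity extends to the whole line because \<open>f\<close> preserves
  \<open>{0..1}\<close> and fixes every point outside. In this form, iterates can be compared
  without tracking the interval.\<close>

lemma strict_mono_Diff1p:
  assumes f: "f \<in> Diff1p"
  shows "strict_mono f"
proof (rule strict_monoI)
  fix x y :: real assume "x < y"
  show "f x < f y"
  proof (cases "x \<in> {0..1} \<and> y \<in> {0..1}")
    case True
    then obtain z where "z \<in> {0..1}" "f y - f x = Dw f z * (y - x)"
      using mvt_unit_interval[of f "Dw f" x y] has_real_derivative_Dw[OF f] \<open>x < y\<close> by auto
    then show ?thesis
      using Dw_pos[OF f] \<open>x < y\<close> by (metis diff_gt_0_iff_gt mult_pos_pos)
  next
    case False
    then show ?thesis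
      using Diff1p_mem[OF f, of x] Diff1p_mem[OF f, of y]
        Diff1p_id_outside[OF f, of x] Diff1p_id_outside[OF f, of y] \<open>x < y\<close>
      by (cases "x \<in> {0..1}"; cases "y \<in> {0..1}") auto
  qed
qed

lemma Diff1p_dinv_f:
  assumes f: "f \<in> Diff1p"
  shows "dinv f (f x) = x"
proof (cases "x \<in> {0..1}")
  case True
  have "inj_on f {0..1}"
    using f unfolding Diff1p_def bij_betw_def by blast
  then show ?thesis
    using True Diff1p_mem[OF f] by (auto simp: dinv_def the_inv_into_f_f)
next
  case False
  then show ?thesis
    by (simp add: dinv_def Diff1p_id_outside[OF f] del: atLeastAtMost_iff)
qed

lemma Diff1p_f_dinv:
  assumes f: "f \<in> Diff1p"
  shows "f (dinv f x) = x"
proof (cases "x \<in> {0..1}")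
  case True
  then obtain y where "x = f y" using Diff1p_image[OF f] by blast
  then show ?thesis by (simp add: Diff1p_dinv_f[OF f])
next
  case False
  then show ?thesis
    by (simp add: dinv_def Diff1p_id_outside[OF f] del: atLeastAtMost_iff)
qed

lemma dinv_mem: "f \<in> Diff1p \<Longrightarrow> x \<in> {0..1} \<Longrightarrow> dinv f x \<in> {0..1}"
  by (metis Diff1p_dinv_f Diff1p_image imageE)

lemma Dw_id: "x \<in> {0..1} \<Longrightarrow> Dw id x = 1"
  by (rule Dw_eq) (simp_all add: id_def)

lemma id_Diff1p: "id \<in> Diff1p"
  by (rule Diff1pI[where D = "\<lambda>_. 1"]) (simp_all add: id_def)

lemma has_real_derivative_comp:
  assumes "f \<in> Diff1p" "g \<in> Diff1p" "x \<in> {0..1}"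
  shows "((f \<circ> g) has_real_derivative Dw f (g x) * Dw g x) (at x within {0..1})"
  using assms DERIV_image_chain[of f "Dw f (g x)" g x "{0..1}" "Dw g x"]
  by (simp add: has_real_derivative_Dw Diff1p_image Diff1p_mem del: atLeastAtMost_iff)

lemma Dw_comp:
  assumes "f \<in> Diff1p" "g \<in> Diff1p" "x \<in> {0..1}"
  shows "Dw (f \<circ> g) x = Dw f (g x) * Dw g x"
  using Dw_eq has_real_derivative_comp assms by blast

lemma comp_Diff1p:
  assumes f: "f \<in> Diff1p" and g: "g \<in> Diff1p"
  shows "f \<circ> g \<in> Diff1p"
proof (rule Diff1pI[where D = "\<lambda>x. Dw f (g x) * Dw g x"])
  show "(f \<circ> g) x = x" if "x \<notin> {0..1}" for x
    using that by (simp add: Diff1p_id_outside[OF f] Diff1p_id_outside[OF g] del: atLeastAtMost_iff)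
  show "continuous_on {0..1} (\<lambda>x. Dw f (g x) * Dw g x)"
    by (intro continuous_on_mult continuous_on_Dw g
        continuous_on_compose2[OF continuous_on_Dw[OF f] continuous_on_Diff1p[OF g]])
      (simp add: Diff1p_image[OF g])
  show "Dw f (g x) * Dw g x > 0" if "x \<in> {0..1}" for x
    using Dw_pos[OF g] Dw_pos[OF f] Diff1p_mem[OF g] that by simp
qed (use assms has_real_derivative_comp in \<open>auto simp: Diff1p_zero Diff1p_one\<close>)

text \<open>This is the inverse function rule relative to \<open>{0..1}\<close>, so that the
  endpoints are covered. The inverse is continuous because \<open>f\<close> is a continuous
  injection on a compact set.\<close>

lemma has_real_derivative_dinv:
  assumes f: "f \<in> Diff1p" and x: "x \<in> {0..1}"
  shows "(dinv f has_real_derivative inverse (Dw f (dinv f x))) (at x within {0..1})"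
proof -
  define y where "y = dinv f x"
  have y: "y \<in> {0..1}" "f y = x"
    using x dinv_mem[OF f] Diff1p_f_dinv[OF f] by (auto simp: y_def)
  have cont: "continuous_on (f ` {0..1}) (dinv f)"
    by (rule continuous_on_inv) (use f in \<open>auto simp: continuous_on_Diff1p Diff1p_dinv_f\<close>)
  have "(dinv f has_derivative (*) (inverse (Dw f y))) (at (f y) within f ` {0..1})"
  proof (rule has_derivative_inverse_within)
    show "(f has_derivative (*) (Dw f y)) (at y within {0..1})"
      using has_real_derivative_Dw[OF f y(1)] by (simp add: has_field_derivative_def)
    show "continuous (at (f y) within f ` {0..1}) (dinv f)"
      using cont y(1) by (simp add: continuous_on_eq_continuous_within del: atLeastAtMost_iff)
    show "linear ((*) (inverse (Dw f y)))"
      by (simp add: linear_times)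
    show "(*) (inverse (Dw f y)) \<circ> (*) (Dw f y) = id"
      using Dw_pos[OF f y(1)] by (auto simp: fun_eq_iff)
  qed (use y(1) Diff1p_dinv_f[OF f] in auto)
  then show ?thesis
    by (simp add: has_field_derivative_def Diff1p_image[OF f] y(2) flip: y_def)
qed

lemma Dw_dinv:
  assumes "f \<in> Diff1p" "x \<in> {0..1}"
  shows "Dw (dinv f) x = inverse (Dw f (dinv f x))"
  using assms Dw_eq has_real_derivative_dinv by blast

lemma dinv_Diff1p:
  assumes f: "f \<in> Diff1p"
  shows "dinv f \<in> Diff1p"
proof (rule Diff1pI[where D = "\<lambda>x. inverse (Dw f (dinv f x))"])
  have cont: "continuous_on {0..1} (dinv f)"
    by (rule DERIV_continuous_on[OF has_real_derivative_dinv[OF f]])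
  show "dinv f 0 = 0" "dinv f 1 = 1"
    using Diff1p_dinv_f[OF f, of 0] Diff1p_dinv_f[OF f, of 1]
    by (simp_all add: Diff1p_zero[OF f] Diff1p_one[OF f])
  show "dinv f x = x" if "x \<notin> {0..1}" for x
    using that by (auto simp: dinv_def)
  show "inverse (Dw f (dinv f x)) > 0" if "x \<in> {0..1}" for x
    using that Dw_pos[OF f] dinv_mem[OF f] by simp
  show "continuous_on {0..1} (\<lambda>x. inverse (Dw f (dinv f x)))"
  proof (intro continuous_on_inverse ballI)
    show "continuous_on {0..1} (\<lambda>x. Dw f (dinv f x))"
      using continuous_on_compose2[OF continuous_on_Dw[OF f] cont] dinv_mem[OF f] by blast
    show "Dw f (dinv f x) \<noteq> 0" if "x \<in> {0..1}" for x
      using that Dw_pos[OF f] dinv_mem[OF f] by force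
  qed
qed (use f has_real_derivative_dinv in blast)

lemma gen_group_Diff1p:
  assumes "S \<subseteq> Diff1p" "g \<in> gen_group S"
  shows "g \<in> Diff1p"
  using assms(2) by induction (use assms(1) id_Diff1p comp_Diff1p dinv_Diff1p in blast)+

subsection \<open>The conjugacy cocycle\<close>

text \<open>Logarithms turn the chain rule into addition. The condition on values follows from the
  one on derivatives: since 0 is fixed, \<open>\<phi> n x - x\<close> equals
  \<open>(Dw (\<phi> n) z - 1) * x\<close> for some \<open>z\<close>.\<close>

lemma C1_to_id_iff_ln_Dw:
  assumes \<phi>: "\<And>n. \<phi> n \<in> Diff1p"
  shows "C1_to_id \<phi> \<longleftrightarrow>
    (\<forall>\<epsilon>>0. \<forall>\<^sub>F n in sequentially. \<forall>x\<in>{0..1}. \<bar>ln (Dw (\<phi> n) x)\<bar> < \<epsilon>)"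
    (is "_ \<longleftrightarrow> ?R")
proof
  assume L: "C1_to_id \<phi>"
  show ?R
  proof (intro allI impI)
    fix \<epsilon> :: real assume "\<epsilon> > 0"
    \<comment> \<open>This threshold gives the lower bound \<open>exp (- \<epsilon>)\<close> at
      once. It also gives the upper bound \<open>exp \<epsilon>\<close>, because
      \<open>exp \<epsilon> + exp (- \<epsilon>)\<close> is twice a hyperbolic cosine and hence at
      least 2.\<close>
    then have "1 - exp (- \<epsilon>) > 0" by simp
    then have "\<forall>\<^sub>F n in sequentially. \<forall>x\<in>{0..1}.
        \<bar>\<phi> n x - x\<bar> < 1 - exp (- \<epsilon>) \<and> \<bar>Dw (\<phi> n) x - 1\<bar> < 1 - exp (- \<epsilon>)"
      using L unfolding C1_to_id_def by blast
    then show "\<forall>\<^sub>F n in sequentially. \<forall>x\<in>{0..1}. \<bar>ln (Dw (\<phi> n) x)\<bar> < \<epsilon>"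
    proof eventually_elim
      case (elim n)
      show ?case
      proof
        fix x :: real assume x: "x \<in> {0..1}"
        then have d: "\<bar>Dw (\<phi> n) x - 1\<bar> < 1 - exp (- \<epsilon>)" and pos: "Dw (\<phi> n) x > 0"
          using elim Dw_pos[OF \<phi>] by auto
        have "exp (- \<epsilon>) < Dw (\<phi> n) x"
          using d by linarith
        then have "ln (exp (- \<epsilon>)) < ln (Dw (\<phi> n) x)"
          using pos by (subst ln_less_cancel_iff) auto
        moreover have "2 \<le> exp \<epsilon> + exp (- \<epsilon>)"
          using cosh_real_ge_1[of \<epsilon>] by (simp add: cosh_field_def)
        then have "Dw (\<phi> n) x < exp \<epsilon>"
          using d by linarith
        then have "ln (Dw (\<phi> n) x) < ln (exp \<epsilon>)"
          using pos by (subst ln_less_cancel_iff) auto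
        ultimately show "\<bar>ln (Dw (\<phi> n) x)\<bar> < \<epsilon>" by simp
      qed
    qed
  qed
next
  assume R: ?R
  show "C1_to_id \<phi>"
    unfolding C1_to_id_def
  proof (intro allI impI)
    fix \<epsilon> :: real assume \<epsilon>: "\<epsilon> > 0"
    \<comment> \<open>With this threshold the derivative lies between
      \<open>1 / (1 + \<epsilon>)\<close> and \<open>1 + \<epsilon>\<close>, and the lower end is at
      least \<open>1 - \<epsilon>\<close>.\<close>
    then have "ln (1 + \<epsilon>) > 0" by simp
    then have "\<forall>\<^sub>F n in sequentially. \<forall>x\<in>{0..1}. \<bar>ln (Dw (\<phi> n) x)\<bar> < ln (1 + \<epsilon>)"
      using R by blast
    then show "\<forall>\<^sub>F n in sequentially. \<forall>x\<in>{0..1}. \<bar>\<phi> n x - x\<bar> < \<epsilon> \<and> \<bar>Dw (\<phi> n) x - 1\<bar> < \<epsilon>"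
    proof eventually_elim
      case (elim n)
      have D: "\<bar>Dw (\<phi> n) x - 1\<bar> < \<epsilon>" if x: "x \<in> {0..1}" for x
      proof -
        have pos: "Dw (\<phi> n) x > 0" by (rule Dw_pos[OF \<phi> x])
        have l: "ln (Dw (\<phi> n) x) < ln (1 + \<epsilon>)" "- ln (1 + \<epsilon>) < ln (Dw (\<phi> n) x)"
          using elim[rule_format, OF x] by linarith+
        have "Dw (\<phi> n) x < 1 + \<epsilon>"
          using l(1) pos \<epsilon> by simp
        moreover have "1 / (1 + \<epsilon>) < Dw (\<phi> n) x"
          using l(2) pos \<epsilon> by (subst ln_less_cancel_iff[symmetric]) (auto simp: ln_div)
        moreover have "1 - \<epsilon> \<le> 1 / (1 + \<epsilon>)"
          using \<epsilon> by (simp add: field_simps)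
        ultimately show ?thesis by linarith
      qed
      show ?case
      proof (intro ballI conjI)
        fix x :: real assume x: "x \<in> {0..1}"
        show "\<bar>Dw (\<phi> n) x - 1\<bar> < \<epsilon>" by (rule D[OF x])
        show "\<bar>\<phi> n x - x\<bar> < \<epsilon>"
        proof (cases "x = 0")
          case True
          then show ?thesis using Diff1p_zero[OF \<phi>] \<epsilon> by simp
        next
          case False
          then obtain z where z: "z \<in> {0..1}" "\<phi> n x - \<phi> n 0 = Dw (\<phi> n) z * (x - 0)"
            using mvt_unit_interval[of "\<phi> n" "Dw (\<phi> n)" 0 x] has_real_derivative_Dw[OF \<phi>] x
            by auto
          have "\<phi> n x - x = (Dw (\<phi> n) z - 1) * x"
            using z(2) Diff1p_zero[OF \<phi>] by (simp add: algebra_simps)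
          then have "\<bar>\<phi> n x - x\<bar> = \<bar>Dw (\<phi> n) z - 1\<bar> * x"
            using x by (simp add: abs_mult)
          also have "\<dots> \<le> \<bar>Dw (\<phi> n) z - 1\<bar>"
            using x by (simp add: mult_left_le)
          finally show ?thesis using D[OF z(1)] by linarith
        qed
      qed
    qed
  qed
qed

definition conj_coc :: "(real \<Rightarrow> real) \<Rightarrow> (real \<Rightarrow> real) \<Rightarrow> real \<Rightarrow> real" where
  "conj_coc h g x = ln (Dw h (g x)) - ln (Dw h x) + ln (Dw g x)"

lemma ln_Dw_conj:
  assumes h: "h \<in> Diff1p" and g: "g \<in> Diff1p" and x: "x \<in> {0..1}"
  shows "ln (Dw (h \<circ> g \<circ> dinv h) (h x)) = conj_coc h g x"
proof -
  have pos: "Dw h (g x) > 0" "Dw h x > 0" "Dw g x > 0"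
    using assms by (auto intro: Dw_pos Diff1p_mem simp del: atLeastAtMost_iff)
  have "Dw (h \<circ> g \<circ> dinv h) (h x) = Dw h (g x) * Dw g x * inverse (Dw h x)"
    by (simp add: Dw_comp comp_Diff1p dinv_Diff1p Diff1p_mem Dw_dinv Diff1p_dinv_f assms
        del: atLeastAtMost_iff)
  then show ?thesis
    using pos by (simp add: conj_coc_def ln_mult ln_inverse)
qed

text \<open>The cocycle at \<open>x\<close> is the log-derivative of the conjugate at
  \<open>h n x\<close>. As \<open>h n\<close> maps \<open>{0..1}\<close> onto itself, uniform bounds
  over either point are the same.\<close>

lemma C1_to_id_conj_iff:
  assumes h: "\<And>n. h n \<in> Diff1p" and g: "g \<in> Diff1p"
  shows "C1_to_id (\<lambda>n. h n \<circ> g \<circ> dinv (h n)) \<longleftrightarrow>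
    (\<forall>\<epsilon>>0. \<forall>\<^sub>F n in sequentially. \<forall>x\<in>{0..1}. \<bar>conj_coc (h n) g x\<bar> < \<epsilon>)"
proof -
  have "(\<forall>y\<in>{0..1}. \<bar>ln (Dw (h n \<circ> g \<circ> dinv (h n)) y)\<bar> < \<epsilon>) \<longleftrightarrow>
      (\<forall>x\<in>{0..1}. \<bar>conj_coc (h n) g x\<bar> < \<epsilon>)" for n \<epsilon>
    by (subst Diff1p_image[OF h[of n], symmetric])
      (simp add: ln_Dw_conj[OF h g] del: atLeastAtMost_iff)
  then show ?thesis
    by (subst C1_to_id_iff_ln_Dw) (simp_all add: comp_Diff1p dinv_Diff1p h g)
qed

text \<open>The two terms \<open>ln (Dw h (k x))\<close> cancel, and the chain rule splits the
  remaining logarithm.\<close>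

lemma conj_coc_comp:
  assumes "g \<in> Diff1p" "k \<in> Diff1p" "x \<in> {0..1}"
  shows "conj_coc h (g \<circ> k) x = conj_coc h g (k x) + conj_coc h k x"
proof -
  have "Dw g (k x) > 0" "Dw k x > 0"
    using assms by (auto intro: Dw_pos Diff1p_mem simp del: atLeastAtMost_iff)
  then show ?thesis
    by (simp add: conj_coc_def Dw_comp[OF assms] ln_mult)
qed

lemma conj_coc_dinv:
  assumes "g \<in> Diff1p" "x \<in> {0..1}"
  shows "conj_coc h (dinv g) x = - conj_coc h g (dinv g x)"
proof -
  have "Dw g (dinv g x) > 0"
    using assms by (auto intro: Dw_pos dinv_mem simp del: atLeastAtMost_iff)
  then show ?thesis
    by (simp add: conj_coc_def Dw_dinv[OF assms] ln_inverse Diff1p_f_dinv[OF assms(1)])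
qed

text \<open>Only generators need checking, for one common sequence \<open>h\<close>. Uniform
  smallness on \<open>{0..1}\<close> passes to products and inverses by the cocycle identities, as
  all maps involved preserve the interval.\<close>

lemma C1_close_id_gen_groupI:
  assumes S: "S \<subseteq> Diff1p" and h: "\<And>n. h n \<in> Diff1p"
    and small: "\<And>g \<epsilon>. g \<in> S \<Longrightarrow> \<epsilon> > 0 \<Longrightarrow>
      \<forall>\<^sub>F n in sequentially. \<forall>x\<in>{0..1}. \<bar>conj_coc (h n) g x\<bar> < \<epsilon>"
  shows "C1_close_id (gen_group S)"
proof -
  have *: "\<forall>\<epsilon>>0. \<forall>\<^sub>F n in sequentially. \<forall>x\<in>{0..1}. \<bar>conj_coc (h n) g x\<bar> < \<epsilon>"
    if "g \<in> gen_group S" for g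
    using that
  proof induction
    case gen_id
    have zero: "conj_coc (h n) id x = 0" if "x \<in> {0..1}" for n x
      by (simp add: conj_coc_def Dw_id[OF that])
    show ?case
      by (intro allI impI always_eventually ballI) (simp only: zero abs_zero)
  next
    case (gen_base s)
    then show ?case using small by blast
  next
    case (gen_comp g k)
    have gk: "g \<in> Diff1p" "k \<in> Diff1p"
      using gen_group_Diff1p[OF S] gen_comp.hyps by auto
    show ?case
    proof (intro allI impI)
      fix \<epsilon> :: real assume "\<epsilon> > 0"
      then have "\<forall>\<^sub>F n in sequentially. \<forall>x\<in>{0..1}. \<bar>conj_coc (h n) g x\<bar> < \<epsilon> / 2"
        and "\<forall>\<^sub>F n in sequentially. \<forall>x\<in>{0..1}. \<bar>conj_coc (h n) k x\<bar> < \<epsilon> / 2"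
        using gen_comp.IH by (meson half_gt_zero)+
      then show "\<forall>\<^sub>F n in sequentially. \<forall>x\<in>{0..1}. \<bar>conj_coc (h n) (g \<circ> k) x\<bar> < \<epsilon>"
      proof eventually_elim
        case (elim n)
        show ?case
        proof
          fix x :: real assume x: "x \<in> {0..1}"
          have "\<bar>conj_coc (h n) g (k x)\<bar> < \<epsilon> / 2" "\<bar>conj_coc (h n) k x\<bar> < \<epsilon> / 2"
            using elim x Diff1p_mem[OF gk(2) x] by blast+
          then show "\<bar>conj_coc (h n) (g \<circ> k) x\<bar> < \<epsilon>"
            unfolding conj_coc_comp[OF gk x] by linarith
        qed
      qed
    qed
  next
    case (gen_inv g)
    have g: "g \<in> Diff1p"
      using gen_group_Diff1p[OF S] gen_inv.hyps by auto
    show ?case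
    proof (intro allI impI)
      fix \<epsilon> :: real assume "\<epsilon> > 0"
      then have "\<forall>\<^sub>F n in sequentially. \<forall>x\<in>{0..1}. \<bar>conj_coc (h n) g x\<bar> < \<epsilon>"
        using gen_inv.IH by blast
      then show "\<forall>\<^sub>F n in sequentially. \<forall>x\<in>{0..1}. \<bar>conj_coc (h n) (dinv g) x\<bar> < \<epsilon>"
        by eventually_elim
          (use dinv_mem[OF g] conj_coc_dinv[OF g] in \<open>simp del: atLeastAtMost_iff\<close>)
    qed
  qed
  have "C1_to_id (\<lambda>n. h n \<circ> g \<circ> dinv (h n))" if "g \<in> gen_group S" for g
    using *[OF that] unfolding C1_to_id_conj_iff[OF h gen_group_Diff1p[OF S that]] .
  with h show ?thesis
    unfolding C1_close_id_def by blast
qed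

text \<open>\<open>H\<close> is the antiderivative of \<open>exp (u x)\<close>, divided by its total
  mass so that 1 is fixed. The normalisation produces the constant \<open>c\<close>, which cancels
  in \<open>conj_coc\<close>.\<close>

lemma exists_Diff1p_with_ln_Dw:
  fixes u :: "real \<Rightarrow> real"
  assumes u: "continuous_on {0..1} u"
  obtains H c where "H \<in> Diff1p" "\<And>x. x \<in> {0..1} \<Longrightarrow> ln (Dw H x) = u x + c"
proof -
  define J where "J x = integral {0..x} (\<lambda>t. exp (u t))" for x
  have J': "(J has_real_derivative exp (u x)) (at x within {0..1})" if "x \<in> {0..1}" for x
    unfolding J_def by (rule integral_has_real_derivative[OF _ that]) (intro continuous_intros u)
  obtain z where "J 1 - J 0 = exp (u z) * (1 - 0)"
    using mvt_unit_interval[OF J', of 0 1] by auto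
  then have J1: "J 1 > 0" and J0: "J 0 = 0"
    by (auto simp: J_def)
  define H where "H x = (if x \<in> {0..1} then J x / J 1 else x)" for x
  have H': "(H has_real_derivative exp (u x) / J 1) (at x within {0..1})" if "x \<in> {0..1}" for x
  proof -
    have "((\<lambda>x. J x / J 1) has_real_derivative exp (u x) / J 1) (at x within {0..1})"
      by (rule DERIV_cdivide[OF J'[OF that]])
    then show ?thesis
      by (rule has_field_derivative_transform_within[OF _ zero_less_one that]) (simp add: H_def)
  qed
  have "H \<in> Diff1p"
    by (rule Diff1pI[where D = "\<lambda>x. exp (u x) / J 1", OF _ _ _ H'])
      (use J0 J1 in \<open>auto simp: H_def intro!: continuous_intros u\<close>)
  moreover have "ln (Dw H x) = u x + (- ln (J 1))" if "x \<in> {0..1}" for x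
    using J1 unfolding Dw_eq[OF H'[OF that] that] by (simp add: ln_div)
  ultimately show thesis by (rule that)
qed

subsection \<open>Approximate coboundaries\<close>

text \<open>Abel summation moves the difference along an orbit onto the weights \<open>c\<close>,
  which will vary by at most \<open>1 / N\<close> per step.\<close>

lemma sum_by_parts:
  fixes c a :: "nat \<Rightarrow> real"
  shows "(\<Sum>k<n. c k * (a (Suc k) - a k)) =
    c n * a n - c 0 * a 0 + (\<Sum>k<n. (c k - c (Suc k)) * a (Suc k))"
  by (induction n) (simp_all add: algebra_simps)

lemma funpow_mem:
  assumes "f \<in> Diff1p" "x \<in> {0..1}"
  shows "(f ^^ k) x \<in> {0..1}"
  by (induction k) (use assms Diff1p_mem in \<open>simp_all del: atLeastAtMost_iff\<close>)

lemma funpow_Diff1p: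
  assumes "f \<in> Diff1p"
  shows "f ^^ k \<in> Diff1p"
  by (induction k) (simp_all only: funpow.simps assms id_Diff1p comp_Diff1p)

lemma continuous_on_sum_funpow:
  assumes f: "f \<in> Diff1p" and v: "continuous_on {0..1} v"
  shows "continuous_on {0..1} (\<lambda>x. \<Sum>k<n. c k * v ((f ^^ k) x) :: real)"
  by (intro continuous_intros continuous_on_compose2[OF v] continuous_on_Diff1p funpow_Diff1p f)
    (use funpow_mem[OF f] in blast)

text \<open>Orbits of a monotone map are monotone sequences, so all increments have the same sign
  and the sum telescopes.\<close>

lemma orbit_variation:
  fixes f :: "real \<Rightarrow> real"
  assumes "mono f"
  shows "(\<Sum>k<n. \<bar>(f ^^ Suc k) x - (f ^^ k) x\<bar>) = \<bar>(f ^^ n) x - x\<bar>"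
proof -
  have mono: "mono (f ^^ k)" for k
    using assms by (rule mono_pow)
  have tele: "(\<Sum>k<n. (f ^^ Suc k) x - (f ^^ k) x) = (f ^^ n) x - x"
    using sum_lessThan_telescope[of "\<lambda>k. (f ^^ k) x" n] by simp
  show ?thesis
  proof (cases "x \<le> f x")
    case True
    then have le: "(f ^^ k) x \<le> (f ^^ Suc k) x" for k
      using monoD[OF mono[of k] True] by (simp add: funpow_swap1)
    then have "(\<Sum>k<n. \<bar>(f ^^ Suc k) x - (f ^^ k) x\<bar>) = (f ^^ n) x - x"
      using tele by simp
    moreover from this have "(f ^^ n) x - x \<ge> 0"
      by (metis abs_ge_zero sum_nonneg)
    ultimately show ?thesis by simp
  next
    case False
    then have le: "(f ^^ Suc k) x \<le> (f ^^ k) x" for k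
      using monoD[OF mono[of k], of "f x" x] by (simp add: funpow_swap1)
    then have "(\<Sum>k<n. \<bar>(f ^^ Suc k) x - (f ^^ k) x\<bar>) = (\<Sum>k<n. - ((f ^^ Suc k) x - (f ^^ k) x))"
      by (intro sum.cong refl abs_of_nonpos) simp
    also have "\<dots> = x - (f ^^ n) x"
      unfolding sum_negf tele by simp
    finally have *: "(\<Sum>k<n. \<bar>(f ^^ Suc k) x - (f ^^ k) x\<bar>) = x - (f ^^ n) x" .
    moreover from this have "x - (f ^^ n) x \<ge> 0"
      by (metis abs_ge_zero sum_nonneg)
    ultimately show ?thesis by simp
  qed
qed

text \<open>The set where \<open>\<bar>v x\<bar>\<close> is at least \<open>\<epsilon>\<close> is
  compact and contains no fixed point, so \<open>\<bar>v x\<bar> / \<bar>f x - x\<bar>\<close> is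
  continuous and bounded there. Elsewhere \<open>\<epsilon>\<close> alone suffices.\<close>

lemma bound_by_displacement:
  fixes f v :: "real \<Rightarrow> real"
  assumes f: "continuous_on {0..1} f" and v: "continuous_on {0..1} v"
    and fix0: "\<And>x. x \<in> {0..1} \<Longrightarrow> f x = x \<Longrightarrow> v x = 0"
    and "\<epsilon> > 0"
  obtains C where "C \<ge> 0" "\<And>x. x \<in> {0..1} \<Longrightarrow> \<bar>v x\<bar> \<le> \<epsilon> + C * \<bar>f x - x\<bar>"
proof -
  define K where "K = {x \<in> {0..1}. \<epsilon> \<le> \<bar>v x\<bar>}"
  have "closed K"
    unfolding K_def by (intro continuous_on_closed_Collect_le continuous_intros v)
  moreover have "bounded K"
    by (rule bounded_subset[of "{0..1}"]) (auto simp: K_def)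
  ultimately have K: "compact K"
    by (simp add: compact_eq_bounded_closed)
  have contK: "continuous_on K (\<lambda>x. \<bar>v x\<bar> / \<bar>f x - x\<bar>)"
    by (intro continuous_intros continuous_on_subset[OF v] continuous_on_subset[OF f])
      (use fix0 \<open>\<epsilon> > 0\<close> in \<open>force simp: K_def\<close>)+
  obtain B where B: "\<And>x. x \<in> K \<Longrightarrow> \<bar>v x\<bar> / \<bar>f x - x\<bar> \<le> B"
    using compact_imp_bounded[OF compact_continuous_image[OF contK K]]
    by (auto simp: bounded_iff)
  show thesis
  \<comment> \<open>The set \<open>K\<close> may be empty, and then \<open>B\<close> is arbitrary;
    the maximum ensures a nonnegative constant.\<close>
  proof (rule that[of "max 0 B"])
    fix x :: real assume x: "x \<in> {0..1}"
    show "\<bar>v x\<bar> \<le> \<epsilon> + max 0 B * \<bar>f x - x\<bar>"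
    proof (cases "x \<in> K")
      case True
      then have "\<bar>f x - x\<bar> > 0"
        using fix0 \<open>\<epsilon> > 0\<close> by (force simp: K_def)
      then have "\<bar>v x\<bar> \<le> B * \<bar>f x - x\<bar>"
        using B[OF True] by (simp add: divide_le_eq)
      also have "\<dots> \<le> max 0 B * \<bar>f x - x\<bar>"
        by (intro mult_right_mono) auto
      finally show ?thesis using \<open>\<epsilon> > 0\<close> by linarith
    next
      case False
      then have "\<bar>v x\<bar> \<le> \<epsilon>" using x by (auto simp: K_def)
      then show ?thesis by (simp add: add_increasing2)
    qed
  qed simp
qed

text \<open>An orbit in \<open>{0..1}\<close> has total displacement at most 1, so the Birkhoff sum
  is at most \<open>N * \<epsilon> / 2 + C\<close>. The constant \<open>C\<close> is absorbed once
  \<open>N\<close> exceeds \<open>2 * C / \<epsilon>\<close>.\<close>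

lemma birkhoff_averages_small:
  fixes f v :: "real \<Rightarrow> real"
  assumes f: "f \<in> Diff1p" and v: "continuous_on {0..1} v"
    and fix0: "\<And>x. x \<in> {0..1} \<Longrightarrow> f x = x \<Longrightarrow> v x = 0"
    and "\<epsilon> > 0"
  obtains N where "N > 0" "\<And>x. x \<in> {0..1} \<Longrightarrow> \<bar>\<Sum>k<N. v ((f ^^ k) x)\<bar> < \<epsilon> * real N"
proof -
  obtain C where C: "C \<ge> 0" "\<And>x. x \<in> {0..1} \<Longrightarrow> \<bar>v x\<bar> \<le> \<epsilon> / 2 + C * \<bar>f x - x\<bar>"
    using bound_by_displacement[OF continuous_on_Diff1p[OF f] v fix0, of "\<epsilon> / 2"] \<open>\<epsilon> > 0\<close>
    by auto
  obtain N :: nat where N: "2 * C / \<epsilon> < real N"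
    using reals_Archimedean2 by blast
  have "N > 0"
    using N C(1) \<open>\<epsilon> > 0\<close> by (cases N) (auto simp: divide_less_0_iff)
  moreover have "\<bar>\<Sum>k<N. v ((f ^^ k) x)\<bar> < \<epsilon> * real N" if x: "x \<in> {0..1}" for x
  proof -
    have "\<bar>\<Sum>k<N. v ((f ^^ k) x)\<bar> \<le> (\<Sum>k<N. \<bar>v ((f ^^ k) x)\<bar>)"
      by (rule sum_abs)
    also have "\<dots> \<le> (\<Sum>k<N. \<epsilon> / 2 + C * \<bar>(f ^^ Suc k) x - (f ^^ k) x\<bar>)"
      using C(2)[OF funpow_mem[OF f x]] by (intro sum_mono) simp
    also have "\<dots> = real N * (\<epsilon> / 2) + C * \<bar>(f ^^ N) x - x\<bar>"
      by (simp add: sum.distrib orbit_variation[OF strict_mono_mono[OF strict_mono_Diff1p[OF f]],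
            simplified] flip: sum_distrib_left)
    also have "C * \<bar>(f ^^ N) x - x\<bar> \<le> C"
      using funpow_mem[OF f x, of N] x C(1) by (intro mult_left_le) auto
    also have "C < real N * (\<epsilon> / 2)"
      using N \<open>\<epsilon> > 0\<close> by (simp add: field_simps)
    finally show ?thesis by (simp add: field_simps)
  qed
  ultimately show thesis by (rule that)
qed

lemma approximate_coboundary:
  fixes f v :: "real \<Rightarrow> real"
  assumes f: "f \<in> Diff1p" and v: "continuous_on {0..1} v"
    and fix0: "\<And>x. x \<in> {0..1} \<Longrightarrow> f x = x \<Longrightarrow> v x = 0"
    and "\<epsilon> > 0"
  obtains u where "continuous_on {0..1} u"
    "\<And>x. x \<in> {0..1} \<Longrightarrow> \<bar>u (f x) - u x + v x\<bar> < \<epsilon>"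
proof -
  obtain N where N: "N > 0"
    and avg: "\<And>x. x \<in> {0..1} \<Longrightarrow> \<bar>\<Sum>k<N. v ((f ^^ k) x)\<bar> < \<epsilon> * real N"
    using birkhoff_averages_small[OF assms] by blast
  define u where "u x = (\<Sum>k<N. (1 - real k / real N) * v ((f ^^ k) x))" for x
  have "continuous_on {0..1} u"
    unfolding u_def by (rule continuous_on_sum_funpow[OF f v])
  moreover have "\<bar>u (f x) - u x + v x\<bar> < \<epsilon>" if x: "x \<in> {0..1}" for x
  proof -
    have "u (f x) - u x =
        (\<Sum>k<N. (1 - real k / real N) * (v ((f ^^ Suc k) x) - v ((f ^^ k) x)))"
      by (simp add: u_def right_diff_distrib sum_subtractf funpow_swap1)
    \<comment> \<open>The weight is 1 at \<open>k = 0\<close>, which yields \<open>- v x\<close>,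
      and 0 at \<open>k = N\<close>, which removes the other boundary term. Each weight drop is
      \<open>1 / N\<close>, leaving the Birkhoff average at \<open>f x\<close>.\<close>
    also have "\<dots> = - v x + (\<Sum>k<N. v ((f ^^ k) (f x))) / real N"
      unfolding sum_by_parts[where c = "\<lambda>k. 1 - real k / real N" and a = "\<lambda>k. v ((f ^^ k) x)"]
      using N by (simp add: funpow_swap1 sum_divide_distrib add_divide_distrib)
    finally have "\<bar>u (f x) - u x + v x\<bar> = \<bar>\<Sum>k<N. v ((f ^^ k) (f x))\<bar> / real N"
      by simp
    also have "\<dots> < \<epsilon>"
      using avg[OF Diff1p_mem[OF f x]] N by (simp add: divide_less_eq)
    finally show ?thesis .
  qed
  ultimately show thesis by (rule that)
qed

subsection \<open>Almost invariant extensions\<close>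

lemma compactly_supported_extension:
  fixes r :: "real \<Rightarrow> real"
  assumes "s < a" "a < b" "b < m" and r: "continuous_on {a..b} r"
  obtains p M where "continuous_on UNIV p" "\<And>x. x \<in> {a..b} \<Longrightarrow> p x = r x"
    "\<And>x. p x \<noteq> 0 \<Longrightarrow> s < x \<and> x < m" "\<And>x. \<bar>p x\<bar> \<le> M"
proof -
  \<comment> \<open>A trapezoidal cutoff: 1 on \<open>{a..b}\<close>, linear on either side, 0 from
    \<open>s\<close> downwards and from \<open>m\<close> upwards. Clamping the argument to
    \<open>{a..b}\<close> extends \<open>r\<close> by constants.\<close>
  define \<rho> where "\<rho> x = max 0 (min 1 (min ((x - s) / (a - s)) ((m - x) / (m - b))))" for x
  define p where "p x = r (max a (min b x)) * \<rho> x" for x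
  have "compact (r ` {a..b})"
    by (rule compact_continuous_image[OF r]) simp
  then obtain M where M: "\<And>x. x \<in> {a..b} \<Longrightarrow> \<bar>r x\<bar> \<le> M"
    using compact_imp_bounded by (force simp: bounded_iff)
  have "continuous_on UNIV \<rho>"
    unfolding \<rho>_def by (intro continuous_intros) (use assms in auto)
  then have "continuous_on UNIV p"
    unfolding p_def
    by (intro continuous_intros continuous_on_compose2[OF r]) (use assms in auto)
  moreover have "p x = r x" if "x \<in> {a..b}" for x
  proof -
    have "1 \<le> (x - s) / (a - s)" "1 \<le> (m - x) / (m - b)"
      using that assms by (auto simp: field_simps)
    then have "\<rho> x = 1" by (simp add: \<rho>_def)
    moreover have "max a (min b x) = x" using that by auto
    ultimately show ?thesis by (simp add: p_def)
  qed
  moreover have "s < x \<and> x < m" if "p x \<noteq> 0" for x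
  proof -
    have "0 < min 1 (min ((x - s) / (a - s)) ((m - x) / (m - b)))"
      by (rule ccontr) (use that in \<open>simp only: p_def \<rho>_def not_less max_absorb1 mult_zero_right simp_thms\<close>)
    then show ?thesis using assms by (auto simp: zero_less_divide_iff)
  qed
  moreover have "\<bar>p x\<bar> \<le> M" for x
  proof -
    have "\<bar>\<rho> x\<bar> \<le> 1" by (simp add: \<rho>_def)
    moreover have "\<bar>r (max a (min b x))\<bar> \<le> M"
      using assms by (intro M) auto
    ultimately show ?thesis
      using mult_mono[of "\<bar>r (max a (min b x))\<bar>" M "\<bar>\<rho> x\<bar>" 1] by (simp add: p_def abs_mult)
  qed
  ultimately show thesis by (rule that)
qed

text \<open>If an iterate lies beyond \<open>z\<close>, the next one lies beyond \<open>F z\<close>.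
  Since the iterates of \<open>F z\<close> increase, no later one falls below \<open>F z\<close>
  again.\<close>

lemma fundamental_domain_hit_once:
  fixes F :: "real \<Rightarrow> real"
  assumes F: "strict_mono F" and "z < F z"
    and "z < (F ^^ j) x" "(F ^^ j) x < F z" "z < (F ^^ k) x" "(F ^^ k) x < F z"
  shows "j = k"
proof -
  have aux: False if "i < l" "z < (F ^^ i) x" "(F ^^ l) x < F z" for i l
  proof -
    have pow: "strict_mono (F ^^ n)" for n
      by (induction n) (use F in \<open>auto simp: strict_mono_def\<close>)
    obtain n where l: "l = n + Suc i"
      using \<open>i < l\<close> by (metis add.commute less_imp_Suc_add add_Suc_right)
    have "incseq (\<lambda>n. (F ^^ n) (F z))"
    proof (rule incseq_SucI)
      show "(F ^^ n) (F z) \<le> (F ^^ Suc n) (F z)" for n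
        using \<open>z < F z\<close> strict_mono_less[OF F] strict_mono_less[OF pow[of n]]
        by (simp add: funpow_swap1 less_imp_le)
    qed
    then have "F z \<le> (F ^^ n) (F z)"
      by (metis funpow_0 le0 incseqD)
    also have "\<dots> < (F ^^ n) (F ((F ^^ i) x))"
      using that strict_mono_less[OF F] strict_mono_less[OF pow[of n]] by simp
    also have "\<dots> = (F ^^ l) x"
      by (simp add: l funpow_add funpow_swap1)
    finally show False using that by simp
  qed
  show ?thesis
    using aux[of j k] aux[of k j] assms by (metis linorder_neqE_nat)
qed

lemma sum_le_of_single:
  fixes a :: "'i \<Rightarrow> real"
  assumes "finite A" and "\<And>i j. i \<in> A \<Longrightarrow> j \<in> A \<Longrightarrow> a i \<noteq> 0 \<Longrightarrow> a j \<noteq> 0 \<Longrightarrow> i = j"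
    and "\<And>i. i \<in> A \<Longrightarrow> \<bar>a i\<bar> \<le> M" and "M \<ge> 0"
  shows "(\<Sum>i\<in>A. \<bar>a i\<bar>) \<le> M"
proof (cases "\<exists>i\<in>A. a i \<noteq> 0")
  case True
  then obtain i where i: "i \<in> A" "a i \<noteq> 0" by blast
  then have "(\<Sum>j\<in>A. \<bar>a j\<bar>) = (\<Sum>j\<in>{i}. \<bar>a j\<bar>)"
    by (intro sum.mono_neutral_right) (use assms in auto)
  then show ?thesis using assms i by simp
next
  case False
  then show ?thesis using assms by simp
qed

text \<open>This is the case where \<open>F\<close> moves the segment to the right. Tent weights of
  slope \<open>1 / N\<close> are summed along an orbit that meets the support at most once, so the
  defect is at most \<open>M / N\<close>.\<close>

lemma almost_invariant_extension_right:
  assumes F: "F \<in> Diff1p" and ab: "a < b" and Fa: "b < F a"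
    and r: "continuous_on {a..b} r" and "\<epsilon> > 0"
  obtains q where "continuous_on {0..1} q" "\<And>x. x \<in> {a..b} \<Longrightarrow> q x = r x"
    "\<And>x. x \<in> {0..1} \<Longrightarrow> \<bar>q (F x) - q x\<bar> < (\<epsilon>::real)"
proof -
  have mono: "strict_mono F" by (rule strict_mono_Diff1p[OF F])
  have G: "dinv F \<in> Diff1p" by (rule dinv_Diff1p[OF F])
  \<comment> \<open>The open interval from \<open>s\<close> to \<open>m = F s\<close> serves as
    fundamental domain; it contains \<open>{a..b}\<close> because \<open>F s = m < F a\<close>
    forces \<open>s < a\<close>.\<close>
  obtain m where m: "b < m" "m < F a" using dense[OF Fa] by blast
  define s where "s = dinv F m"
  have Fs: "F s = m" by (simp add: s_def Diff1p_f_dinv[OF F])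
  have "s < a" using m strict_mono_less[OF mono, of s a] by (simp add: Fs)
  obtain p M where p: "continuous_on UNIV p" "\<And>x. x \<in> {a..b} \<Longrightarrow> p x = r x"
    "\<And>x. p x \<noteq> 0 \<Longrightarrow> s < x \<and> x < m" "\<And>x. \<bar>p x\<bar> \<le> M"
    using compactly_supported_extension[OF \<open>s < a\<close> ab m(1) r] by blast
  have "M \<ge> 0" using p(4)[of 0] by linarith
  obtain N :: nat where "M / \<epsilon> < real N"
    using reals_Archimedean2 by blast
  then have N: "N > 0" "M / real N < \<epsilon>"
    using \<open>\<epsilon> > 0\<close> \<open>M \<ge> 0\<close> by (cases N; auto simp: field_simps)+
  have powFG: "(F ^^ n) ((dinv F ^^ n) x) = x" for n x
    by (induction n arbitrary: x) (simp_all add: funpow_swap1 Diff1p_f_dinv[OF F])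
  have powGF: "(dinv F ^^ n) ((F ^^ n) x) = x" for n x
    by (induction n arbitrary: x) (simp_all add: funpow_swap1 Diff1p_dinv_f[OF F])
  have pow: "strict_mono (F ^^ n)" for n
    by (rule strict_mono_Diff1p[OF funpow_Diff1p[OF F]])
  \<comment> \<open>\<open>R\<close> is \<open>p\<close> transported by \<open>F ^^ N\<close>; its
    support lies between \<open>z\<close> and \<open>F z\<close>, the image of the fundamental
    domain.\<close>
  define R where "R x = p ((dinv F ^^ N) x)" for x
  define z where "z = (F ^^ N) s"
  have z: "z < F z"
  proof -
    have "s < F s" using \<open>s < a\<close> ab m by (simp add: Fs)
    then have "(F ^^ N) s < (F ^^ N) (F s)" by (rule strict_monoD[OF pow])
    then show ?thesis by (simp add: z_def funpow_swap1)
  qed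
  have Rz: "z < x \<and> x < F z" if "R x \<noteq> 0" for x
  proof -
    have "s < (dinv F ^^ N) x" "(dinv F ^^ N) x < F s"
      using p(3) that by (auto simp: R_def Fs)
    then have "(F ^^ N) s < (F ^^ N) ((dinv F ^^ N) x)" "(F ^^ N) ((dinv F ^^ N) x) < (F ^^ N) (F s)"
      by (auto intro: strict_monoD[OF pow])
    then show ?thesis by (simp add: powFG z_def funpow_swap1)
  qed
  have once: "j = k" if "R ((F ^^ j) x) \<noteq> 0" "R ((F ^^ k) x) \<noteq> 0" for j k x
    using fundamental_domain_hit_once[OF mono z] Rz[OF that(1)] Rz[OF that(2)] by blast
  have contR: "continuous_on {0..1} R"
    unfolding R_def
    by (intro continuous_on_compose2[OF p(1)] continuous_on_Diff1p funpow_Diff1p G) auto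
  \<comment> \<open>Shifting by \<open>N\<close> turns the two-sided sum over \<open>\<bar>k\<bar> < N\<close> into one over forward iterates only.\<close>
  define c where "c k = 1 - \<bar>real k - real N\<bar> / real N" for k
  define q where "q x = (\<Sum>k<2 * N. c k * R ((F ^^ k) x))" for x
  have "continuous_on {0..1} q"
    unfolding q_def by (rule continuous_on_sum_funpow[OF F contR])
  moreover have "q x = r x" if x: "x \<in> {a..b}" for x
  proof -
    have RN: "R ((F ^^ N) x) = r x"
      by (simp add: R_def powGF p(2)[OF x])
    have zN: "z < (F ^^ N) x" "(F ^^ N) x < F z"
    proof -
      have "s < x" "x < F s" using x \<open>s < a\<close> m Fs by auto
      then have "(F ^^ N) s < (F ^^ N) x" "(F ^^ N) x < (F ^^ N) (F s)"
        by (auto intro: strict_monoD[OF pow])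
      then show "z < (F ^^ N) x" "(F ^^ N) x < F z" by (simp_all add: z_def funpow_swap1)
    qed
    \<comment> \<open>The iterate with \<open>k = N\<close> lies in the shifted domain, so no other
      does. Only the peak of the tent contributes, with weight \<open>c N = 1\<close>.\<close>
    have "R ((F ^^ k) x) = 0" if "k \<noteq> N" for k
      using fundamental_domain_hit_once[OF mono z _ _ zN] Rz that by blast
    then have "q x = (\<Sum>k\<in>{N}. c k * R ((F ^^ k) x))"
      unfolding q_def using N(1) by (intro sum.mono_neutral_right) auto
    then show ?thesis by (simp add: c_def RN)
  qed
  moreover have "\<bar>q (F x) - q x\<bar> < \<epsilon>" if x: "x \<in> {0..1}" for x
  proof -
    have c: "\<bar>c k - c (Suc k)\<bar> \<le> 1 / real N" for k
    proof -
      have "c k - c (Suc k) = (\<bar>real (Suc k) - real N\<bar> - \<bar>real k - real N\<bar>) / real N"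
        by (simp add: c_def diff_divide_distrib)
      then show ?thesis
        by (simp add: abs_divide divide_right_mono)
    qed
    have "q (F x) - q x = (\<Sum>k<2 * N. c k * (R ((F ^^ Suc k) x) - R ((F ^^ k) x)))"
      by (simp add: q_def right_diff_distrib sum_subtractf funpow_swap1)
    \<comment> \<open>The tent vanishes at both ends, \<open>c 0 = c (2 * N) = 0\<close>, so
      summation by parts has no boundary terms.\<close>
    also have "\<dots> = (\<Sum>k<2 * N. (c k - c (Suc k)) * R ((F ^^ Suc k) x))"
      unfolding sum_by_parts[where c = c and a = "\<lambda>k. R ((F ^^ k) x)"]
      using N(1) by (simp add: c_def)
    finally have "\<bar>q (F x) - q x\<bar> \<le> (\<Sum>k<2 * N. \<bar>(c k - c (Suc k)) * R ((F ^^ Suc k) x)\<bar>)"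
      by (simp only: sum_abs)
    also have "\<dots> \<le> (\<Sum>k<2 * N. 1 / real N * \<bar>R ((F ^^ Suc k) x)\<bar>)"
      unfolding abs_mult by (intro sum_mono mult_right_mono c) simp
    also have "\<dots> = (\<Sum>k<2 * N. \<bar>R ((F ^^ Suc k) x)\<bar>) / real N"
      by (simp add: sum_divide_distrib)
    also have "\<dots> \<le> M / real N"
    proof (intro divide_right_mono sum_le_of_single)
      show "i = j" if "R ((F ^^ Suc i) x) \<noteq> 0" "R ((F ^^ Suc j) x) \<noteq> 0" for i j
        using once[OF that] by simp
    qed (use \<open>M \<ge> 0\<close> p(4) in \<open>auto simp: R_def\<close>)
    finally show ?thesis using N(2) by linarith
  qed
  ultimately show thesis by (rule that)
qed

text \<open>A segment disjoint from its image is pushed entirely to one side. If that side is the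
  left, the inverse pushes it right, and a bound for \<open>dinv f\<close> taken at
  \<open>f x\<close> is a bound for \<open>f\<close> at \<open>x\<close>.\<close>

lemma almost_invariant_extension:
  assumes f: "f \<in> Diff1p" and ab: "0 < a" "a < b" "b < 1" and disj: "f ` {a..b} \<inter> {a..b} = {}"
    and r: "continuous_on {a..b} r" and "\<epsilon> > 0"
  obtains q where "continuous_on {0..1} q" "\<And>x. x \<in> {a..b} \<Longrightarrow> q x = r x"
    "\<And>x. x \<in> {0..1} \<Longrightarrow> \<bar>q (f x) - q x\<bar> < (\<epsilon>::real)"
proof -
  have "b < f a \<or> f b < a"
  proof (rule ccontr)
    assume "\<not> (b < f a \<or> f b < a)"
    \<comment> \<open>Otherwise disjointness puts \<open>f a\<close> to the left of the segment and
      \<open>f b\<close> to the right, and the intermediate value theorem finds a point of the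
      segment mapped to \<open>a\<close>.\<close>
    then have "f a \<le> b" "a \<le> f b" by auto
    moreover have "f a \<notin> {a..b}" "f b \<notin> {a..b}"
      using disj ab imageI[of a "{a..b}" f] imageI[of b "{a..b}" f] by fastforce+
    ultimately have "f a \<le> a" "b \<le> f b" by auto
    moreover have "continuous_on {a..b} f"
      using ab by (intro continuous_on_subset[OF continuous_on_Diff1p[OF f]]) auto
    ultimately obtain x where "x \<in> {a..b}" "f x = a"
      using IVT'[of f a a b] ab by auto
    then have "a \<in> f ` {a..b} \<inter> {a..b}" using ab by auto
    then show False using disj by blast
  qed
  then show thesis
  proof
    assume "b < f a"
    then show thesis
      using almost_invariant_extension_right[OF f ab(2) _ r \<open>\<epsilon> > 0\<close>] that by blast
  next
    assume "f b < a"
    then have "dinv f (f b) < dinv f a"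
      by (rule strict_monoD[OF strict_mono_Diff1p[OF dinv_Diff1p[OF f]]])
    then have "b < dinv f a" by (simp add: Diff1p_dinv_f[OF f])
    then obtain q where q: "continuous_on {0..1} q" "\<And>x. x \<in> {a..b} \<Longrightarrow> q x = r x"
      "\<And>x. x \<in> {0..1} \<Longrightarrow> \<bar>q (dinv f x) - q x\<bar> < \<epsilon>"
      using almost_invariant_extension_right[OF dinv_Diff1p[OF f] ab(2) _ r \<open>\<epsilon> > 0\<close>] by blast
    have "\<bar>q (f x) - q x\<bar> < \<epsilon>" if "x \<in> {0..1}" for x
      using q(3)[OF Diff1p_mem[OF f that]] by (simp add: Diff1p_dinv_f[OF f] abs_minus_commute)
    with q show thesis by (intro that)
  qed
qed

subsection \<open>The conjugating diffeomorphisms\<close>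

text \<open>On \<open>{a..b}\<close>, which \<open>g\<close> preserves, the constant
  \<open>c\<close> cancels in the difference. Off \<open>{a..b}\<close>, \<open>g\<close> is the
  identity near \<open>x\<close>, so the whole cocycle vanishes. Values of \<open>H\<close> outside
  the segment are thus invisible to \<open>g\<close>.\<close>

lemma conj_coc_supported:
  assumes g: "g \<in> Diff1p"
    and supp: "\<And>x. x \<notin> {a..b} \<Longrightarrow> g x = x"
    and x: "x \<in> {0..1}"
    and H: "\<And>y. y \<in> {a..b} \<Longrightarrow> ln (Dw H y) = ln (Dw h y) + c"
  shows "conj_coc H g x = (if x \<in> {a..b} then conj_coc h g x else 0)"
proof (cases "x \<in> {a..b}")
  case True
  \<comment> \<open>A value outside would be fixed by \<open>g\<close>, and injectivity would make
    it equal to \<open>x\<close>, which lies inside.\<close>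
  have "g x \<in> {a..b}"
  proof (rule ccontr)
    assume *: "g x \<notin> {a..b}"
    then have "g (g x) = g x" by (rule supp)
    then have "g x = x" using strict_mono_eq[OF strict_mono_Diff1p[OF g]] by blast
    with True * show False by simp
  qed
  then show ?thesis
    using True H by (simp add: conj_coc_def del: atLeastAtMost_iff)
next
  case False
  have "((\<lambda>x. x) has_real_derivative 1) (at x within {0..1})" by simp
  moreover have "\<forall>\<^sub>F y in at x within {0..1}. y = g y"
  proof -
    have "open (- {a..b})" by auto
    then have "\<forall>\<^sub>F y in nhds x. y \<in> - {a..b}"
      using False by (intro eventually_nhds_in_open) auto
    then have "\<forall>\<^sub>F y in at x within {0..1}. y \<in> - {a..b}"
      unfolding eventually_at_filter by (rule eventually_mono) simp
    then show ?thesis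
      by (rule eventually_mono) (use supp in fastforce)
  qed
  ultimately have "(g has_real_derivative 1) (at x within {0..1})"
    using supp[OF False] by (subst (asm) has_field_derivative_cong_eventually) auto
  then show ?thesis
    using Dw_eq x supp[OF False] False by (simp add: conj_coc_def)
qed

theorem theoremt:
  fixes a b :: real and G :: "(real \<Rightarrow> real) set" and f :: "real \<Rightarrow> real"
  assumes "0 < a" "a < b" "b < 1"
    and "diff_group G"
    and "\<forall>g\<in>G. \<forall>x. x \<notin> {a..b} \<longrightarrow> g x = x"
    and "C1_close_id G"
    and "f \<in> Diff1p"
    and "no_hyp_fixed f"
    and "f ` {a..b} \<inter> {a..b} = {}"
  shows "C1_close_id (gen_group (insert f G))"
proof -
  note ab = assms(1-3) and supp = assms(5) and f = assms(7) and disj = assms(9)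
  have G: "G \<subseteq> Diff1p" using assms(4) by (simp add: diff_group_def)
  obtain h where h: "\<And>n. h n \<in> Diff1p"
    and hG: "\<And>g. g \<in> G \<Longrightarrow> C1_to_id (\<lambda>n. h n \<circ> g \<circ> dinv (h n))"
    using assms(6) unfolding C1_close_id_def by blast
  have "\<exists>H c. H \<in> Diff1p \<and> (\<forall>x\<in>{a..b}. ln (Dw H x) = ln (Dw (h n) x) + c)
      \<and> (\<forall>x\<in>{0..1}. \<bar>conj_coc H f x\<bar> < 1 / real (Suc n))" for n
  proof -
    \<comment> \<open>Half of the allowed error goes to the approximate coboundary \<open>u\<close>,
      half to the correction \<open>q\<close>.\<close>
    define \<epsilon> where "\<epsilon> = 1 / real (Suc n) / 2"
    have "\<epsilon> > 0" by (simp add: \<epsilon>_def)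
    have fix0: "ln (Dw f x) = 0" if "x \<in> {0..1}" "f x = x" for x
      using assms(8) that by (simp add: no_hyp_fixed_def)
    obtain u where u: "continuous_on {0..1} u"
      "\<And>x. x \<in> {0..1} \<Longrightarrow> \<bar>u (f x) - u x + ln (Dw f x)\<bar> < \<epsilon>"
      using approximate_coboundary[OF f continuous_on_ln_Dw[OF f] fix0 \<open>\<epsilon> > 0\<close>] by blast
    \<comment> \<open>The correction is prescribed on the segment so that \<open>u + q\<close>
      agrees there with \<open>ln (Dw (h n) x)\<close>; its almost invariance keeps the estimate for
      \<open>f\<close>.\<close>
    have "{a..b} \<subseteq> {0..1}" using ab by auto
    then have "continuous_on {a..b} (\<lambda>x. ln (Dw (h n) x) - u x)"
      by (intro continuous_on_diff continuous_on_subset[OF u(1)]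
          continuous_on_subset[OF continuous_on_ln_Dw[OF h]])
    then obtain q where q: "continuous_on {0..1} q"
      "\<And>x. x \<in> {a..b} \<Longrightarrow> q x = ln (Dw (h n) x) - u x"
      "\<And>x. x \<in> {0..1} \<Longrightarrow> \<bar>q (f x) - q x\<bar> < \<epsilon>"
      using almost_invariant_extension[OF f ab disj _ \<open>\<epsilon> > 0\<close>] by blast
    obtain H c where H: "H \<in> Diff1p" "\<And>x. x \<in> {0..1} \<Longrightarrow> ln (Dw H x) = u x + q x + c"
      using exists_Diff1p_with_ln_Dw[OF continuous_on_add[OF u(1) q(1)]] by blast
    have "\<bar>conj_coc H f x\<bar> < 1 / real (Suc n)" if x: "x \<in> {0..1}" for x
    proof -
      have "conj_coc H f x = (u (f x) - u x + ln (Dw f x)) + (q (f x) - q x)"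
        by (simp add: conj_coc_def H(2)[OF x] H(2)[OF Diff1p_mem[OF f x]])
      moreover have "\<epsilon> + \<epsilon> = 1 / real (Suc n)" unfolding \<epsilon>_def by (rule field_sum_of_halves)
      ultimately show ?thesis using u(2)[OF x] q(3)[OF x] by linarith
    qed
    moreover have "ln (Dw H x) = ln (Dw (h n) x) + c" if "x \<in> {a..b}" for x
      using H(2)[of x] q(2)[OF that] that ab by simp
    ultimately show ?thesis using H(1) by blast
  qed
  then obtain H c where H: "\<And>n. H n \<in> Diff1p"
    and Hh: "\<And>n x. x \<in> {a..b} \<Longrightarrow> ln (Dw (H n) x) = ln (Dw (h n) x) + c n"
    and Hf: "\<And>n x. x \<in> {0..1} \<Longrightarrow> \<bar>conj_coc (H n) f x\<bar> < 1 / real (Suc n)"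
    by metis
  show ?thesis
  proof (rule C1_close_id_gen_groupI[OF _ H])
    fix g and \<epsilon> :: real assume g: "g \<in> insert f G" and \<epsilon>: "\<epsilon> > 0"
    show "\<forall>\<^sub>F n in sequentially. \<forall>x\<in>{0..1}. \<bar>conj_coc (H n) g x\<bar> < \<epsilon>"
    proof (cases "g = f")
      case True
      have "\<forall>\<^sub>F n in sequentially. 1 / real (Suc n) < \<epsilon>"
        using order_tendstoD(2)[OF LIMSEQ_Suc[OF lim_1_over_n] \<epsilon>] by simp
      then show ?thesis
        by eventually_elim (use Hf True in \<open>meson less_trans\<close>)
    next
      case False
      then have "g \<in> G" using g by simp
      then have gD: "g \<in> Diff1p" using G by blast
      have "\<forall>\<^sub>F n in sequentially. \<forall>x\<in>{0..1}. \<bar>conj_coc (h n) g x\<bar> < \<epsilon>"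
        using hG[OF \<open>g \<in> G\<close>] \<epsilon> unfolding C1_to_id_conj_iff[OF h gD] by blast
      then show ?thesis
      \<comment> \<open>For members of \<open>G\<close>, the cocycle of \<open>H n\<close> is that
        of \<open>h n\<close> on the segment and 0 elsewhere, so the bound carries over.\<close>
      proof eventually_elim
        case (elim n)
        have "conj_coc (H n) g x = (if x \<in> {a..b} then conj_coc (h n) g x else 0)"
          if "x \<in> {0..1}" for x
          by (rule conj_coc_supported[OF gD _ that Hh]) (use supp \<open>g \<in> G\<close> in blast)
        then show ?case using elim \<epsilon> by simp
      qed
    qed
  qed (use f G in simp)
qed

end
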